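(* For every $q\in(1,2]$ there are constants $c(q),c_1(q),c_2(q)>0$, depending only on $q$, such that the following holds. Let $N\in\mathbb N$, and let $\mathbf g$ be a uniformly distributed random element of $G=\mathbb Z_2^N\times\mathbb Z_N$, acting on $\mathbb R^N$ by sign changes and cyclic shifts of coordinates. For every $x\in\mathbb R^N$ and every integer $0\le n<N$, $$d_n^{\mathrm{avg}}(\mathbf gx,\ell_q^N)_q\ \ge\ c(q)\,(1-n/N)^{1/q}\,\|x\|_q .$$ Moreover, for every $n$-dimensional linear subspace $Q_n\subset\mathbb R^N$, $$\mathsf P\left\{\rho(\mathbf gx,Q_n)_q\ge c_1(q)(1-n/N)^{1/q}\|x\|_q\right\}\ \ge\ c_2(q)(1-n/N).$$
   Context: The element $(\tau,k)\in G=\mathbb Z_2^N\times\mathbb Z_N$ acts by $(\tau,k)x=((-1)^{\tau_1}x_{k+1},\dots,(-1)^{\tau_N}x_{k+N})$, indices taken mod $N$. $\ell_q^N$ is $\mathbb R^N$ with the norm $\|x\|_q=(\sum_{k=1}^N|x_k|^q)^{1/q}$, and $\rho(x,Q)_q=\inf_{y\in Q}\|x-y\|_q$. For a random vector $\xi$ in $\mathbb R^N$, $d_n^{\mathrm{avg}}(\xi,\ell_q^N)_q=\inf_{Q_n}\left(\mathsf E\,\rho(\xi,Q_n)_q^q\right)^{1/q}$, the infimum over all linear subspaces $Q_n\subset\mathbb R^N$ of dimension at most $n$. *)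

theory Defs
  imports "HOL-Probability.Probability" "HOL-Library.Function_Algebras"
begin

text \<open>
  The constants of the theorem must not depend on \<open>N\<close>, so \<open>N\<close> is quantified inside the formula and
  cannot be a type. As in the library's \<^const>\<open>Euclidean_space\<close>, a vector of dimension \<open>N\<close>
  is a sequence vanishing from index \<open>N\<close> on; coordinates are numbered \<open>0, \<dots>, N - 1\<close>. Pointwise
  scalar multiplication makes the library's \<^const>\<open>subspace\<close> and \<^const>\<open>dim\<close> available.
\<close>

instantiation "fun" :: (type, real_vector) real_vector
begin

definition "scaleR c f = (\<lambda>i. c *\<^sub>R f i)"

instance
  by standard (simp_all add: scaleR_fun_def fun_eq_iff scaleR_add_right scaleR_add_left)

end

lemma scaleR_fun_apply [simp]: "(c *\<^sub>R f) i = c *\<^sub>R f i"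
  by (simp add: scaleR_fun_def)

definition real_space :: "nat \<Rightarrow> (nat \<Rightarrow> real) set" where
  "real_space N = {x. \<forall>i\<ge>N. x i = 0}"

definition lq_norm :: "real \<Rightarrow> nat \<Rightarrow> (nat \<Rightarrow> real) \<Rightarrow> real" where
  "lq_norm q N x = (\<Sum>k<N. \<bar>x k\<bar> powr q) powr (1 / q)"

definition lq_dist :: "real \<Rightarrow> nat \<Rightarrow> (nat \<Rightarrow> real) \<Rightarrow> (nat \<Rightarrow> real) set \<Rightarrow> real" where
  "lq_dist q N x Q = (INF y\<in>Q. lq_norm q N (x - y))"

text \<open>
  The random vector is a function \<open>\<xi>\<close> on a probability space \<open>M\<close>. The expectation is the Bochner
  integral, so the definition is meaningful only when the \<open>q\<close>-th moment of \<open>\<xi>\<close> is finite, as it is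
  for random vectors with finitely many values.
\<close>

definition avg_width ::
    "real \<Rightarrow> nat \<Rightarrow> nat \<Rightarrow> 'w measure \<Rightarrow> ('w \<Rightarrow> nat \<Rightarrow> real) \<Rightarrow> real" where
  "avg_width q N n M \<xi> =
     (INF Q\<in>{Q. subspace Q \<and> Q \<subseteq> real_space N \<and> dim Q \<le> n}.
        (LINT \<omega>|M. lq_dist q N (\<xi> \<omega>) Q powr q) powr (1 / q))"

text \<open>
  The underlying set of \<open>\<int>\<^sub>2\<^sup>N \<times> \<int>\<^sub>N\<close>, with residues represented by \<open>0, 1\<close> and \<open>0, \<dots>, N - 1\<close>. Its group
  law plays no role here: only the uniform distribution on the elements and the maps by which they
  act are used.
\<close>

definition sign_shift_group :: "nat \<Rightarrow> ((nat \<Rightarrow> nat) \<times> nat) set" where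
  "sign_shift_group N = ({..<N} \<rightarrow>\<^sub>E {0, 1}) \<times> {..<N}"

definition act :: "nat \<Rightarrow> (nat \<Rightarrow> nat) \<times> nat \<Rightarrow> (nat \<Rightarrow> real) \<Rightarrow> nat \<Rightarrow> real" where
  "act N = (\<lambda>(\<tau>, k) x i. if i < N then (-1) ^ \<tau> i * x ((k + i) mod N) else 0)"

end

theory Submission
  imports Defs
begin

text \<open>
  The width is bounded below by duality. Let \<open>p = q / (q - 1) \<ge> 2\<close> be the conjugate exponent and
  let \<open>y\<close> be the dual vector of \<open>x\<close>, so that \<open>x k * y k = \<bar>x k\<bar>\<^sup>q = \<bar>y k\<bar>\<^sup>p\<close>. Write \<open>A\<close> for the
  \<open>q\<close>-th power of the norm of \<open>x\<close>. For a subspace \<open>Q\<close> of dimension at most \<open>n\<close> let \<open>P\<close> be the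
  orthogonal projection onto its orthogonal complement; its trace \<open>T\<close> is at least \<open>N - n\<close>. The
  random functional \<open>P (g y)\<close> annihilates \<open>Q\<close>, and it is a good test for the distance from \<open>g x\<close>
  to \<open>Q\<close>, because of two averages over the group.

  First, random signs kill the off-diagonal terms of \<open>\<langle>g x, P (g y)\<rangle>\<close> and the random shift makes the
  diagonal ones equal on average, so the mean of this quantity is exactly \<open>T A / N\<close>
  (\<open>sum_act_quadratic_form\<close>). Second, the mean of the \<open>p\<close>-th power of the \<open>p\<close>-norm of \<open>P (g y)\<close> is
  at most \<open>C T A / N\<close> with \<open>C\<close> depending only on \<open>p\<close> (\<open>sum_act_projection_powr_le\<close>): after
  Khinchine's inequality the \<open>i\<close>-th coordinate is governed by the weights \<open>(P i j)\<^sup>2\<close>, whose sum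
  over \<open>j\<close> is \<open>P i i \<le> 1\<close>, and Jensen's inequality for the exponent \<open>p / 2 \<ge> 1\<close> applies. It is
  essential that the second bound carries the same factor \<open>T / N\<close> as the first.

  Young's inequality with a small constant in front of the \<open>p\<close>-th powers gives, for each \<open>g\<close>, the bound
  \<open>\<langle>g x, P (g y)\<rangle> \<le> K \<rho>\<^sup>q + W / (2 C)\<close>, where \<open>\<rho>\<close> is the distance from \<open>g x\<close> to \<open>Q\<close> and \<open>W\<close> the
  \<open>p\<close>-th power just estimated (\<open>bilinear_form_le_lq_dist\<close>). After averaging, the last term is at
  most half of the left-hand side, so the mean of \<open>\<rho>\<^sup>q\<close> is at least \<open>\<kappa> (1 - n / N) A\<close> with
  \<open>\<kappa> = 1 / (2 K)\<close>. This is the bound on the width. The bound on the probability follows because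
  \<open>\<rho>\<^sup>q \<le> A\<close> always: a variable between \<open>0\<close> and \<open>A\<close> with mean at least \<open>\<kappa> (1 - n / N) A\<close> is at least half
  of that value with probability at least \<open>\<kappa> (1 - n / N) / 2\<close>.
\<close>

section \<open>Orthogonal projections annihilating a subspace\<close>

text \<open>
  The \<open>N\<close>-by-\<open>N\<close> matrices of orthogonal projections whose kernel contains \<open>B\<close>. The kernel may be
  larger than the span of \<open>B\<close>; a lower bound on the trace, stated separately, keeps it small.
\<close>

definition annihilating_projection ::
    "nat \<Rightarrow> (nat \<Rightarrow> real) set \<Rightarrow> (nat \<Rightarrow> nat \<Rightarrow> real) \<Rightarrow> bool" where
  "annihilating_projection N B P \<longleftrightarrow>
    (\<forall>i<N. \<forall>j<N. P i j = P j i) \<and>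
    (\<forall>i<N. \<forall>k<N. (\<Sum>j<N. P i j * P j k) = P i k) \<and>
    (\<forall>b\<in>B. \<forall>i<N. (\<Sum>j<N. P i j * b j) = 0)"

lemma annihilating_projectionD:
  assumes "annihilating_projection N B P"
  shows "\<And>i j. i < N \<Longrightarrow> j < N \<Longrightarrow> P i j = P j i"
    and "\<And>i k. i < N \<Longrightarrow> k < N \<Longrightarrow> (\<Sum>j<N. P i j * P j k) = P i k"
    and "\<And>b i. b \<in> B \<Longrightarrow> i < N \<Longrightarrow> (\<Sum>j<N. P i j * b j) = 0"
  using assms unfolding annihilating_projection_def by blast+

text \<open>
  Gram--Schmidt in matrix form. To annihilate one more vector \<open>b\<close>, subtract from \<open>P\<close> the
  projection onto the line through \<open>v = P b\<close>; this line lies in the range of \<open>P\<close> and is orthogonal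
  to all vectors annihilated so far, so the difference is again a projection and the trace
  drops by one. If \<open>v = 0\<close> there is nothing to do.
\<close>

lemma annihilating_projection_finite:
  assumes "finite B"
  shows "\<exists>P. annihilating_projection N B P \<and> real N - real (card B) \<le> (\<Sum>i<N. P i i)"
  using assms
proof (induction B)
  case empty
  have "(\<Sum>j<N. (if i = j then 1 else 0) * (if j = k then 1 else 0)) = (if i = k then 1 else (0::real))"
    if "i < N" for i k
    using that by (simp add: if_distrib[of "\<lambda>u. u * _"] cong: if_cong)
  then show ?case
    by (intro exI[of _ "\<lambda>i j. if i = j then 1 else 0"]) (simp add: annihilating_projection_def)
next
  case (insert b B)
  then obtain P where P: "annihilating_projection N B P"
    and tr: "real N - real (card B) \<le> (\<Sum>i<N. P i i)"
    by blast
  note sym = annihilating_projectionD(1)[OF P] and idem = annihilating_projectionD(2)[OF P]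
    and ker = annihilating_projectionD(3)[OF P]
  define v where "v i = (\<Sum>j<N. P i j * b j)" for i
  define s where "s = (\<Sum>i<N. v i * v i)"
  have Pv: "(\<Sum>j<N. P i j * v j) = v i" if "i < N" for i
  proof -
    have "(\<Sum>j<N. P i j * v j) = (\<Sum>j<N. \<Sum>k<N. P i j * P j k * b k)"
      by (simp add: v_def sum_distrib_left mult.assoc)
    also have "\<dots> = (\<Sum>k<N. (\<Sum>j<N. P i j * P j k) * b k)"
      by (subst sum.swap) (simp add: sum_distrib_right)
    also have "\<dots> = v i"
      unfolding v_def using idem that by (intro sum.cong) auto
    finally show ?thesis .
  qed
  have v_inner: "(\<Sum>i<N. v i * w i) = (\<Sum>j<N. (\<Sum>i<N. P j i * w i) * b j)" for w
  proof -
    have "(\<Sum>i<N. v i * w i) = (\<Sum>i<N. \<Sum>j<N. P i j * w i * b j)"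
      by (simp add: v_def sum_distrib_left sum_distrib_right mult_ac)
    also have "\<dots> = (\<Sum>j<N. \<Sum>i<N. P j i * w i * b j)"
      by (subst sum.swap) (auto intro!: sum.cong simp: sym)
    finally show ?thesis by (simp add: sum_distrib_right)
  qed
  have vb: "(\<Sum>i<N. v i * b i) = s"
    unfolding s_def v_inner[of v] using Pv by (intro sum.cong) auto
  have vB: "(\<Sum>i<N. v i * b' i) = 0" if "b' \<in> B" for b'
    unfolding v_inner[of b'] using ker[OF that] by (intro sum.neutral) auto
  show ?case
  proof (cases "s = 0")
    case True
    then have "v i = 0" if "i < N" for i
      using that unfolding s_def by (subst (asm) sum_nonneg_eq_0_iff) auto
    then have "\<forall>b'\<in>insert b B. \<forall>i<N. (\<Sum>j<N. P i j * b' j) = 0"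
      using ker by (auto simp: v_def)
    moreover have "real N - real (card (insert b B)) \<le> (\<Sum>i<N. P i i)"
      using tr insert.hyps by simp
    ultimately show ?thesis
      using P unfolding annihilating_projection_def by blast
  next
    case False
    define P' where "P' i j = P i j - v i * v j / s" for i j
    have P'_apply: "(\<Sum>j<N. P' i j * w j) = (\<Sum>j<N. P i j * w j) - v i * (\<Sum>j<N. v j * w j) / s"
      for i w
      by (simp add: P'_def algebra_simps sum_subtractf sum_distrib_left sum_divide_distrib)
    have P'_v: "(\<Sum>j<N. P' i j * v j) = 0" if "i < N" for i
      unfolding P'_apply using False that by (simp add: Pv s_def[symmetric])
    have "\<forall>i<N. \<forall>j<N. P' i j = P' j i"
      using sym by (simp add: P'_def mult_ac)
    moreover have "(\<Sum>j<N. P' i j * P' j k) = P' i k" if "i < N" "k < N" for i k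
    proof -
      have vP: "(\<Sum>j<N. v j * P j k) = v k"
        using Pv[of k] that by (simp add: sym mult.commute cong: sum.cong_simp)
      have "(\<Sum>j<N. P' i j * P' j k) = (\<Sum>j<N. P' i j * P j k) - (\<Sum>j<N. P' i j * v j) * v k / s"
        by (simp add: P'_def[of _ k] right_diff_distrib sum_subtractf sum_distrib_left
            sum_divide_distrib mult_ac)
      also have "\<dots> = P' i k"
        unfolding P'_v[OF that(1)] P'_apply[of i "\<lambda>j. P j k"] vP idem[OF that]
        by (simp add: P'_def)
      finally show ?thesis .
    qed
    moreover have "\<forall>b'\<in>insert b B. \<forall>i<N. (\<Sum>j<N. P' i j * b' j) = 0"
      unfolding P'_apply using ker vB vb False by (auto simp: v_def)
    moreover have "(\<Sum>i<N. P' i i) = (\<Sum>i<N. P i i) - 1"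
      using False by (simp add: P'_def sum_subtractf sum_divide_distrib[symmetric] s_def[symmetric])
    then have "real N - real (card (insert b B)) \<le> (\<Sum>i<N. P' i i)"
      using tr insert.hyps by simp
    ultimately show ?thesis
      by (intro exI[of _ P']) (simp add: annihilating_projection_def)
  qed
qed

lemma independent_real_space_finite:
  assumes "independent B" "B \<subseteq> real_space N"
  shows "finite B"
proof -
  define e where "e i = (\<lambda>j. if j = i then 1 else 0 :: real)" for i :: nat
  have "x \<in> span (e ` {..<N})" if "x \<in> real_space N" for x
  proof -
    have "(\<Sum>i<n. x i *\<^sub>R e i) j = (if j < n then x j else 0)" for n j
      by (induction n) (auto simp: e_def less_Suc_eq)
    then have "x = (\<Sum>i<N. x i *\<^sub>R e i)"
      using that by (auto simp: real_space_def fun_eq_iff)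
    also have "\<dots> \<in> span (e ` {..<N})"
      by (intro span_sum span_scale span_base) auto
    finally show ?thesis .
  qed
  then have "B \<subseteq> span (e ` {..<N})" using assms(2) by blast
  with assms(1) show ?thesis
    using independent_span_bound[of "e ` {..<N}" B] by auto
qed

lemma annihilating_projection_subspace:
  assumes "Q \<subseteq> real_space N"
  shows "\<exists>P. annihilating_projection N Q P \<and> real N - real (dim Q) \<le> (\<Sum>i<N. P i i)"
proof -
  obtain B where B: "B \<subseteq> Q" "independent B" "Q \<subseteq> span B" "card B = dim Q"
    using basis_exists[of Q] by blast
  have "finite B" using B assms by (intro independent_real_space_finite) auto
  then obtain P where P: "annihilating_projection N B P"
    and tr: "real N - real (card B) \<le> (\<Sum>i<N. P i i)"
    using annihilating_projection_finite by blast
  have "(\<Sum>j<N. P i j * u j) = 0" if "u \<in> Q" "i < N" for u i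
  proof -
    have "u \<in> span B" using that B by blast
    then show ?thesis
    proof (induction rule: span_induct)
      case base
      show ?case
        by (auto simp: subspace_def distrib_left sum.distrib mult.left_commute
            sum_distrib_left[symmetric])
    next
      case (step b)
      then show ?case using annihilating_projectionD(3)[OF P] that by simp
    qed
  qed
  then have "annihilating_projection N Q P"
    using P unfolding annihilating_projection_def by blast
  then show ?thesis using tr B(4) by auto
qed

section \<open>Inequalities for real powers and exponentials\<close>

text \<open>
  Jensen's inequality for \<open>t \<mapsto> t\<^sup>r\<close> with weights of total mass at most one. With \<open>m\<close> the left-hand
  sum, it is the sum of Young's inequalities \<open>b j * m\<^sup>r\<^sup>-\<^sup>1 \<le> (b j)\<^sup>r / r + m\<^sup>r (1 - 1 / r)\<close> with the
  weights \<open>w j\<close>. Mass below one has to be allowed: the weights to come are the squares in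
  a row of a projection matrix.
\<close>

lemma powr_sum_le_sum_powr:
  fixes w b :: "'a \<Rightarrow> real"
  assumes "1 \<le> r" and w: "\<And>j. j \<in> I \<Longrightarrow> 0 \<le> w j" and b: "\<And>j. j \<in> I \<Longrightarrow> 0 \<le> b j"
    and w1: "sum w I \<le> 1"
  shows "(\<Sum>j\<in>I. w j * b j) powr r \<le> (\<Sum>j\<in>I. w j * b j powr r)"
proof (cases "r = 1")
  case True
  then show ?thesis using w b by (simp add: sum_nonneg cong: sum.cong_simp)
next
  case False
  with assms(1) have r: "1 < r" by simp
  define m where "m = (\<Sum>j\<in>I. w j * b j)"
  have m: "0 \<le> m" unfolding m_def using w b by (intro sum_nonneg) auto
  have young: "b j * m powr (r - 1) \<le> b j powr r / r + m powr r * (1 - 1 / r)" if "j \<in> I" for j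
  proof -
    have "(r - 1) * (r / (r - 1)) = r" using r by simp
    then have "(m powr (r - 1)) powr (r / (r - 1)) = m powr r" by (simp add: powr_powr)
    moreover have "b j * m powr (r - 1) \<le> b j powr r / r + (m powr (r - 1)) powr (r / (r - 1)) / (r / (r - 1))"
      using r b[OF that] by (intro Youngs_inequality) (auto simp: field_simps)
    ultimately show ?thesis using r by (simp add: field_simps)
  qed
  have "m powr r = m * m powr (r - 1)"
    using m r by (cases "m = 0") (auto simp: powr_mult_base)
  also have "\<dots> = (\<Sum>j\<in>I. w j * (b j * m powr (r - 1)))"
    by (simp add: m_def sum_distrib_right mult.assoc)
  also have "\<dots> \<le> (\<Sum>j\<in>I. w j * (b j powr r / r + m powr r * (1 - 1 / r)))"
    using w young by (intro sum_mono mult_left_mono) auto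
  also have "\<dots> = (\<Sum>j\<in>I. w j * b j powr r) / r + sum w I * (m powr r * (1 - 1 / r))"
    by (simp add: distrib_left sum.distrib sum_divide_distrib sum_distrib_right)
  also have "\<dots> \<le> (\<Sum>j\<in>I. w j * b j powr r) / r + 1 * (m powr r * (1 - 1 / r))"
    using w1 r by (intro add_left_mono mult_right_mono) auto
  finally have "m powr r / r \<le> (\<Sum>j\<in>I. w j * b j powr r) / r"
    using r by (simp add: field_simps)
  then show ?thesis using r by (simp add: m_def divide_le_cancel)
qed

text \<open>
  A crude form of \<open>cosh a \<le> exp (a\<^sup>2 / 2)\<close>, enough for a sub-Gaussian bound on sums of signs.
  For \<open>0 \<le> a\<close>, the bound on \<open>exp (- a)\<close> comes from \<open>(1 + a) (1 - a + a\<^sup>2) = 1 + a\<^sup>3 \<ge> 1\<close>.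
\<close>

lemma exp_plus_exp_minus_le:
  fixes a :: real
  assumes "\<bar>a\<bar> \<le> 1"
  shows "exp a + exp (- a) \<le> 2 * exp (a\<^sup>2)"
proof -
  have aux: "exp b + exp (- b) \<le> 2 * exp (b\<^sup>2)" if "0 \<le> b" "b \<le> 1" for b :: real
  proof -
    have "1 \<le> (1 + b) * (1 - b + b\<^sup>2)" using that by (simp add: algebra_simps power2_eq_square)
    also have "\<dots> \<le> exp b * (1 - b + b\<^sup>2)"
      using that by (intro mult_right_mono exp_ge_add_one_self) auto
    finally have "exp (- b) \<le> 1 - b + b\<^sup>2" by (simp add: exp_minus field_simps)
    moreover have "exp b \<le> 1 + b + b\<^sup>2" using that by (rule exp_bound)
    moreover have "1 + b\<^sup>2 \<le> exp (b\<^sup>2)" by (rule exp_ge_add_one_self)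
    ultimately show ?thesis by linarith
  qed
  show ?thesis using aux[of "\<bar>a\<bar>"] assms by (cases "0 \<le> a") (auto simp: add.commute)
qed

lemma powr_le_exp:
  fixes s p :: real
  assumes "0 \<le> s" "0 < p"
  shows "s powr p \<le> p powr p * exp s"
proof (cases "s = 0")
  case False
  then have s: "0 < s" using assms by simp
  have "ln (s / p) \<le> s / p" using ln_le_minus_one[of "s / p"] s assms by simp
  then have "p * ln s \<le> p * ln p + s" using s assms by (simp add: ln_div field_simps)
  then show ?thesis using s assms by (simp add: powr_def exp_add[symmetric])
qed simp

text \<open>
  Either \<open>u\<close> is at most \<open>\<delta> v\<^sup>p\<^sup>-\<^sup>1\<close>, where \<open>p - 1 = 1 / (q - 1)\<close>, and the second term alone bounds
  the product, or \<open>v\<close> is at most \<open>(u / \<delta>)\<^sup>q\<^sup>-\<^sup>1\<close> and the first one does.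
\<close>

lemma young_with_small_constant:
  fixes q \<delta> u v :: real
  assumes q: "1 < q" and \<delta>: "0 < \<delta>" and u: "0 \<le> u" and v: "0 \<le> v"
  shows "u * v \<le> \<delta> powr (1 - q) * u powr q + \<delta> * v powr (q / (q - 1))"
proof (cases "u \<le> \<delta> * v powr (1 / (q - 1))")
  case True
  have "v powr (q / (q - 1)) = v powr (1 / (q - 1)) * v"
  proof -
    have "1 + 1 / (q - 1) = q / (q - 1)" using q by (simp add: field_simps)
    then show ?thesis using powr_mult_base[OF v, of "1 / (q - 1)"] by (simp add: mult.commute)
  qed
  then have "u * v \<le> \<delta> * v powr (q / (q - 1))"
    using mult_right_mono[OF True v] by (simp add: mult.assoc)
  moreover have "0 \<le> \<delta> powr (1 - q) * u powr q" by simp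
  ultimately show ?thesis by linarith
next
  case False
  then have u: "0 < u" using \<delta> by (smt (verit) mult_nonneg_nonneg powr_ge_zero)
  have "v powr (1 / (q - 1)) \<le> u / \<delta>" using False \<delta> by (simp add: field_simps)
  then have "(v powr (1 / (q - 1))) powr (q - 1) \<le> (u / \<delta>) powr (q - 1)"
    using q by (intro powr_mono2) auto
  then have "v \<le> (u / \<delta>) powr (q - 1)" using q v by (simp add: powr_powr)
  then have "u * v \<le> u * (u / \<delta>) powr (q - 1)" using u by simp
  also have "\<dots> = \<delta> powr (1 - q) * u powr q"
    using u \<delta> by (simp add: powr_divide powr_diff)
  also have "\<dots> \<le> \<delta> powr (1 - q) * u powr q + \<delta> * v powr (q / (q - 1))"
    using \<delta> by simp
  finally show ?thesis .
qed

section \<open>Averages over signs and shifts\<close>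

abbreviation sign_patterns :: "nat \<Rightarrow> (nat \<Rightarrow> nat) set" where
  "sign_patterns N \<equiv> {..<N} \<rightarrow>\<^sub>E {0, 1}"

lemma card_sign_patterns: "card (sign_patterns N) = 2 ^ N"
  by (simp add: card_PiE numeral_2_eq_2)

lemma sum_sign_patterns_prod:
  fixes h :: "nat \<Rightarrow> nat \<Rightarrow> real"
  shows "(\<Sum>\<tau>\<in>sign_patterns N. \<Prod>l<N. h l (\<tau> l)) = (\<Prod>l<N. h l 0 + h l 1)"
  by (subst prod_sum_PiE[symmetric]) auto

lemma sum_signs_orthogonal:
  assumes "i < N" "j < N"
  shows "(\<Sum>\<tau>\<in>sign_patterns N. (-1) ^ \<tau> i * (-1) ^ \<tau> j) = (if i = j then 2 ^ N else (0::real))"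
proof (cases "i = j")
  case True
  then show ?thesis
    by (simp add: card_sign_patterns power_add[symmetric] mult_2[symmetric] power_mult
        del: One_nat_def)
next
  case False
  define h :: "nat \<Rightarrow> nat \<Rightarrow> real" where "h l t = (if l = i \<or> l = j then (-1) ^ t else 1)" for l t
  have "(-1) ^ \<tau> i * (-1) ^ \<tau> j = (\<Prod>l<N. h l (\<tau> l))" for \<tau> :: "nat \<Rightarrow> nat"
  proof -
    have "(\<Prod>l<N. h l (\<tau> l)) = (\<Prod>l\<in>{i, j}. h l (\<tau> l))"
      using assms by (intro prod.mono_neutral_right) (auto simp: h_def)
    then show ?thesis using False by (simp add: h_def)
  qed
  then have "(\<Sum>\<tau>\<in>sign_patterns N. (-1) ^ \<tau> i * (-1) ^ \<tau> j) = (\<Prod>l<N. h l 0 + h l 1)"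
    by (simp add: sum_sign_patterns_prod del: One_nat_def)
  also have "\<dots> = 0" using assms(1) by (intro prod_zero) (auto simp: h_def)
  finally show ?thesis using False by simp
qed

text \<open>
  The exponential moment factorizes over the coordinates by independence of the signs.
\<close>

lemma sum_signs_exp_le:
  assumes "(\<Sum>j<N. (a j)\<^sup>2) \<le> (1::real)"
  shows "(\<Sum>\<tau>\<in>sign_patterns N. exp (\<Sum>j<N. a j * (-1) ^ \<tau> j)) \<le> 2 ^ N * exp 1"
proof -
  have a1: "\<bar>a j\<bar> \<le> 1" if "j < N" for j
  proof -
    have "(a j)\<^sup>2 \<le> (\<Sum>j<N. (a j)\<^sup>2)" using that by (intro member_le_sum) auto
    with assms have "(a j)\<^sup>2 \<le> 1" by linarith
    then show ?thesis by (simp add: abs_square_le_1)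
  qed
  have "(\<Sum>\<tau>\<in>sign_patterns N. exp (\<Sum>j<N. a j * (-1) ^ \<tau> j))
      = (\<Sum>\<tau>\<in>sign_patterns N. \<Prod>j<N. exp (a j * (-1) ^ \<tau> j))"
    by (simp add: exp_sum)
  also have "\<dots> = (\<Prod>j<N. exp (a j) + exp (- a j))"
    by (subst sum_sign_patterns_prod[where h = "\<lambda>j t. exp (a j * (-1) ^ t)"]) simp
  also have "\<dots> \<le> (\<Prod>j<N. 2 * exp ((a j)\<^sup>2))"
    using a1 by (intro prod_mono conjI exp_plus_exp_minus_le add_nonneg_nonneg) auto
  also have "\<dots> = 2 ^ N * exp (\<Sum>j<N. (a j)\<^sup>2)"
    by (simp add: prod.distrib exp_sum)
  also have "\<dots> \<le> 2 ^ N * exp 1" using assms by simp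
  finally show ?thesis .
qed

text \<open>
  Upper half of Khinchine's inequality. After normalization the sum \<open>X\<close> of signs has
  exponential moments at most \<open>exp 1\<close> on both sides, and \<open>\<bar>X\<bar>\<^sup>p\<close> is dominated by a multiple of
  \<open>exp X + exp (- X)\<close>. The constant is far from optimal; only its independence of \<open>N\<close> and \<open>a\<close> matters.
\<close>

lemma khinchine_upper:
  fixes a :: "nat \<Rightarrow> real"
  assumes p: "0 < p"
  shows "(\<Sum>\<tau>\<in>sign_patterns N. \<bar>\<Sum>j<N. a j * (-1) ^ \<tau> j\<bar> powr p)
    \<le> 2 * exp 1 * p powr p * 2 ^ N * (\<Sum>j<N. (a j)\<^sup>2) powr (p / 2)"
proof (cases "(\<Sum>j<N. (a j)\<^sup>2) = 0")
  case True
  then have "a j = 0" if "j < N" for j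
    using that by (subst (asm) sum_nonneg_eq_0_iff) auto
  then show ?thesis by simp
next
  case False
  define \<sigma> where "\<sigma> = sqrt (\<Sum>j<N. (a j)\<^sup>2)"
  have S0: "0 \<le> (\<Sum>j<N. (a j)\<^sup>2)" by (intro sum_nonneg) auto
  with False have \<sigma>: "0 < \<sigma>" by (simp add: \<sigma>_def)
  have \<sigma>2: "\<sigma>\<^sup>2 = (\<Sum>j<N. (a j)\<^sup>2)" using S0 by (simp add: \<sigma>_def)
  define X where "X \<tau> = (\<Sum>j<N. (a j / \<sigma>) * (-1) ^ \<tau> j)" for \<tau> :: "nat \<Rightarrow> nat"
  have norm1: "(\<Sum>j<N. (a j / \<sigma>)\<^sup>2) = 1"
    using \<sigma> by (simp add: power_divide sum_divide_distrib[symmetric] \<sigma>2[symmetric])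
  have exp_bounds: "(\<Sum>\<tau>\<in>sign_patterns N. exp (X \<tau>)) \<le> 2 ^ N * exp 1"
      "(\<Sum>\<tau>\<in>sign_patterns N. exp (- X \<tau>)) \<le> 2 ^ N * exp 1"
    using sum_signs_exp_le[where a = "\<lambda>j. a j / \<sigma>"] sum_signs_exp_le[where a = "\<lambda>j. - (a j / \<sigma>)"] norm1
    by (simp_all add: X_def sum_negf)
  have "\<bar>X \<tau>\<bar> powr p \<le> p powr p * (exp (X \<tau>) + exp (- X \<tau>))" for \<tau>
  proof -
    have "\<bar>X \<tau>\<bar> powr p \<le> p powr p * exp \<bar>X \<tau>\<bar>" using p by (intro powr_le_exp) auto
    also have "\<dots> \<le> p powr p * (exp (X \<tau>) + exp (- X \<tau>))"
      by (intro mult_left_mono) (auto simp: abs_if)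
    finally show ?thesis .
  qed
  then have "(\<Sum>\<tau>\<in>sign_patterns N. \<bar>X \<tau>\<bar> powr p)
      \<le> p powr p * ((\<Sum>\<tau>\<in>sign_patterns N. exp (X \<tau>)) + (\<Sum>\<tau>\<in>sign_patterns N. exp (- X \<tau>)))"
    by (simp add: sum_distrib_left sum.distrib[symmetric] distrib_left[symmetric] sum_mono)
  also have "\<dots> \<le> p powr p * (2 ^ N * exp 1 + 2 ^ N * exp 1)"
    using exp_bounds by (intro mult_left_mono add_mono) auto
  finally have main: "(\<Sum>\<tau>\<in>sign_patterns N. \<bar>X \<tau>\<bar> powr p) \<le> 2 * exp 1 * p powr p * 2 ^ N"
    by (simp add: mult_ac)
  have \<sigma>p: "\<sigma> powr p = (\<Sum>j<N. (a j)\<^sup>2) powr (p / 2)"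
    unfolding \<sigma>2[symmetric] using \<sigma> by (simp add: powr_realpow[symmetric] powr_powr del: powr_numeral)
  have "(\<Sum>j<N. a j * (-1) ^ \<tau> j) = \<sigma> * X \<tau>" for \<tau>
    using \<sigma> by (simp add: X_def sum_distrib_left)
  then have "(\<Sum>\<tau>\<in>sign_patterns N. \<bar>\<Sum>j<N. a j * (-1) ^ \<tau> j\<bar> powr p)
      = \<sigma> powr p * (\<Sum>\<tau>\<in>sign_patterns N. \<bar>X \<tau>\<bar> powr p)"
    using \<sigma> by (simp add: abs_mult powr_mult sum_distrib_left)
  also have "\<dots> \<le> \<sigma> powr p * (2 * exp 1 * p powr p * 2 ^ N)"
    using main by (intro mult_left_mono) auto
  finally show ?thesis by (simp add: \<sigma>p mult_ac)
qed

lemma sum_cyclic_shift: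
  fixes h :: "nat \<Rightarrow> 'a::comm_monoid_add"
  shows "(\<Sum>k<N. h ((k + i) mod N)) = (\<Sum>k<N. h k)"
proof (cases "N = 0")
  case False
  have "inj_on (\<lambda>k. (k + i) mod N) {..<N}"
  proof (rule inj_onI)
    have aux: "k = l" if "k \<le> l" "l < N" "(l + i) mod N = (k + i) mod N" for k l
    proof -
      have "N dvd l - k" using that mod_eq_dvd_iff_nat[of "k + i" "l + i" N] by simp
      then show ?thesis using that by (auto dest: dvd_imp_le)
    qed
    fix k l assume "k \<in> {..<N}" "l \<in> {..<N}" "(k + i) mod N = (l + i) mod N"
    then show "k = l" using aux[of k l] aux[of l k] by (cases "k \<le> l") auto
  qed
  moreover have "(\<lambda>k. (k + i) mod N) ` {..<N} = {..<N}"
    using False calculation by (intro endo_inj_surj) auto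
  ultimately show ?thesis
    using sum.reindex[of "\<lambda>k. (k + i) mod N" "{..<N}" h] by simp
qed simp

lemma sum_sign_shift_group:
  "(\<Sum>g\<in>sign_shift_group N. F g) = (\<Sum>k<N. \<Sum>\<tau>\<in>sign_patterns N. F (\<tau>, k))"
  unfolding sign_shift_group_def by (subst sum.swap) (simp add: sum.cartesian_product)

lemma card_sign_shift_group: "card (sign_shift_group N) = 2 ^ N * N"
  by (simp add: sign_shift_group_def card_cartesian_product card_sign_patterns del: One_nat_def)

lemma finite_sign_shift_group: "finite (sign_shift_group N)"
  unfolding sign_shift_group_def by (intro finite_cartesian_product finite_PiE) auto

text \<open>
  Off the diagonal the signs of \<open>g x\<close> and \<open>g y\<close> are independent and average out; on the diagonal
  they cancel, and summing over shifts turns each \<open>x (k + i) * y (k + i)\<close> into the inner product.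
\<close>

lemma sum_act_quadratic_form:
  "(\<Sum>g\<in>sign_shift_group N. \<Sum>i<N. \<Sum>j<N. P i j * (act N g x i * act N g y j))
    = 2 ^ N * (\<Sum>i<N. P i i) * (\<Sum>k<N. x k * y k)"
proof -
  have signs: "(\<Sum>\<tau>\<in>sign_patterns N. \<Sum>i<N. \<Sum>j<N. P i j * (act N (\<tau>, k) x i * act N (\<tau>, k) y j))
      = (\<Sum>i<N. 2 ^ N * P i i * (x ((k + i) mod N) * y ((k + i) mod N)))" for k
  proof -
    have "(\<Sum>\<tau>\<in>sign_patterns N. \<Sum>i<N. \<Sum>j<N. P i j * (act N (\<tau>, k) x i * act N (\<tau>, k) y j))
      = (\<Sum>i<N. \<Sum>j<N. \<Sum>\<tau>\<in>sign_patterns N. P i j * (act N (\<tau>, k) x i * act N (\<tau>, k) y j))"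
    proof -
      have "(\<Sum>\<tau>\<in>sign_patterns N. \<Sum>i<N. \<Sum>j<N. P i j * (act N (\<tau>, k) x i * act N (\<tau>, k) y j))
        = (\<Sum>i<N. \<Sum>\<tau>\<in>sign_patterns N. \<Sum>j<N. P i j * (act N (\<tau>, k) x i * act N (\<tau>, k) y j))"
        by (rule sum.swap)
      also have "\<dots> = (\<Sum>i<N. \<Sum>j<N. \<Sum>\<tau>\<in>sign_patterns N. P i j * (act N (\<tau>, k) x i * act N (\<tau>, k) y j))"
        by (intro sum.cong refl sum.swap)
      finally show ?thesis .
    qed
    also have "\<dots> = (\<Sum>i<N. \<Sum>j<N. P i j * x ((k + i) mod N) * y ((k + j) mod N)
        * (\<Sum>\<tau>\<in>sign_patterns N. (-1) ^ \<tau> i * (-1) ^ \<tau> j))"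
      by (intro sum.cong refl) (simp add: act_def sum_distrib_left mult_ac)
    also have "\<dots> = (\<Sum>i<N. \<Sum>j<N. if i = j then 2 ^ N * P i j * x ((k + i) mod N) * y ((k + j) mod N) else 0)"
      by (intro sum.cong refl) (simp add: sum_signs_orthogonal mult_ac del: One_nat_def)
    also have "\<dots> = (\<Sum>i<N. 2 ^ N * P i i * (x ((k + i) mod N) * y ((k + i) mod N)))"
      by (intro sum.cong refl) (simp add: mult_ac)
    finally show ?thesis .
  qed
  have "(\<Sum>g\<in>sign_shift_group N. \<Sum>i<N. \<Sum>j<N. P i j * (act N g x i * act N g y j))
      = (\<Sum>k<N. \<Sum>i<N. 2 ^ N * P i i * (x ((k + i) mod N) * y ((k + i) mod N)))"
    unfolding sum_sign_shift_group signs ..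
  also have "\<dots> = (\<Sum>i<N. 2 ^ N * P i i * (\<Sum>k<N. x ((k + i) mod N) * y ((k + i) mod N)))"
    by (subst sum.swap) (simp add: sum_distrib_left)
  also have "\<dots> = (\<Sum>i<N. 2 ^ N * P i i * (\<Sum>k<N. x k * y k))"
    by (subst sum_cyclic_shift[where h = "\<lambda>k. x k * y k"]) simp
  finally show ?thesis
    by (simp add: sum_distrib_left[symmetric] sum_distrib_right[symmetric])
qed

section \<open>Testing the distance with a projected dual vector\<close>

text \<open>
  Symmetry and idempotence give \<open>P i i = (\<Sum>j. (P i j)\<^sup>2)\<close>, which is at least \<open>(P i i)\<^sup>2\<close>.
\<close>

lemma projection_diagonal:
  assumes P: "annihilating_projection N Q P" and "i < N"
  shows "(\<Sum>j<N. (P i j)\<^sup>2) = P i i" and "P i i \<le> 1" and "0 \<le> P i i"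
proof -
  have "(\<Sum>j<N. (P i j)\<^sup>2) = (\<Sum>j<N. P i j * P j i)"
    using annihilating_projectionD(1)[OF P] assms(2) by (intro sum.cong) (auto simp: power2_eq_square)
  then show row: "(\<Sum>j<N. (P i j)\<^sup>2) = P i i"
    using annihilating_projectionD(2)[OF P] assms(2) by simp
  show nonneg: "0 \<le> P i i" unfolding row[symmetric] by (intro sum_nonneg) auto
  have "(P i i)\<^sup>2 \<le> (\<Sum>j<N. (P i j)\<^sup>2)" using assms(2) by (intro member_le_sum) auto
  then have "P i i * P i i \<le> P i i * 1" unfolding row by (simp add: power2_eq_square)
  with nonneg show "P i i \<le> 1" by (cases "P i i = 0") (auto simp: mult_le_cancel_left)
qed

text \<open>
  Khinchine's inequality bounds the average over signs of the \<open>p\<close>-th power of the \<open>i\<close>-th coordinate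
  by a multiple of the power \<open>p / 2\<close> of \<open>\<Sum>j. (P i j)\<^sup>2 * (y (k + j))\<^sup>2\<close>. Jensen's inequality moves this power inside, so that the
  sum over shifts can be carried out, and the remaining \<open>\<Sum>i j. (P i j)\<^sup>2\<close> is the trace.
\<close>

lemma sum_act_projection_powr_le:
  assumes P: "annihilating_projection N Q P" and p: "2 \<le> p"
  shows "(\<Sum>g\<in>sign_shift_group N. \<Sum>i<N. \<bar>\<Sum>j<N. P i j * act N g y j\<bar> powr p)
    \<le> 2 * exp 1 * p powr p * 2 ^ N * (\<Sum>i<N. P i i) * (\<Sum>k<N. \<bar>y k\<bar> powr p)"
proof -
  define C where "C = 2 * exp 1 * p powr p * 2 ^ N"
  have C: "0 \<le> C" by (simp add: C_def)
  define S where "S = (\<Sum>k<N. \<bar>y k\<bar> powr p)"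
  have signs: "(\<Sum>\<tau>\<in>sign_patterns N. \<bar>\<Sum>j<N. P i j * act N (\<tau>, k) y j\<bar> powr p)
      \<le> C * (\<Sum>j<N. (P i j)\<^sup>2 * \<bar>y ((k + j) mod N)\<bar> powr p)" if "i < N" for i k
  proof -
    let ?a = "\<lambda>j. P i j * y ((k + j) mod N)"
    have "(\<Sum>\<tau>\<in>sign_patterns N. \<bar>\<Sum>j<N. P i j * act N (\<tau>, k) y j\<bar> powr p)
        = (\<Sum>\<tau>\<in>sign_patterns N. \<bar>\<Sum>j<N. ?a j * (-1) ^ \<tau> j\<bar> powr p)"
      by (simp add: act_def mult_ac)
    also have "\<dots> \<le> C * (\<Sum>j<N. (?a j)\<^sup>2) powr (p / 2)"
      unfolding C_def using p by (intro khinchine_upper) auto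
    also have "(\<Sum>j<N. (?a j)\<^sup>2) powr (p / 2)
        = (\<Sum>j<N. (P i j)\<^sup>2 * (y ((k + j) mod N))\<^sup>2) powr (p / 2)"
      by (simp add: power_mult_distrib)
    also have "\<dots> \<le> (\<Sum>j<N. (P i j)\<^sup>2 * (y ((k + j) mod N))\<^sup>2 powr (p / 2))"
      using p projection_diagonal[OF P that] by (intro powr_sum_le_sum_powr) auto
    also have "\<dots> = (\<Sum>j<N. (P i j)\<^sup>2 * \<bar>y ((k + j) mod N)\<bar> powr p)"
    proof -
      have "(t\<^sup>2) powr (p / 2) = \<bar>t\<bar> powr p" for t :: real
        using powr_powr[of "\<bar>t\<bar>" 2 "p / 2"] by (cases "t = 0") auto
      then show ?thesis by simp
    qed
    finally show ?thesis using C by (simp add: mult_left_mono)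
  qed
  have "(\<Sum>g\<in>sign_shift_group N. \<Sum>i<N. \<bar>\<Sum>j<N. P i j * act N g y j\<bar> powr p)
      = (\<Sum>k<N. \<Sum>i<N. \<Sum>\<tau>\<in>sign_patterns N. \<bar>\<Sum>j<N. P i j * act N (\<tau>, k) y j\<bar> powr p)"
    unfolding sum_sign_shift_group by (intro sum.cong refl sum.swap)
  also have "\<dots> \<le> (\<Sum>k<N. \<Sum>i<N. C * (\<Sum>j<N. (P i j)\<^sup>2 * \<bar>y ((k + j) mod N)\<bar> powr p))"
    using signs by (intro sum_mono) auto
  also have "\<dots> = (\<Sum>i<N. \<Sum>j<N. C * (P i j)\<^sup>2 * (\<Sum>k<N. \<bar>y ((k + j) mod N)\<bar> powr p))"
  proof -
    have "(\<Sum>k<N. \<Sum>i<N. \<Sum>j<N. C * ((P i j)\<^sup>2 * \<bar>y ((k + j) mod N)\<bar> powr p))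
        = (\<Sum>i<N. \<Sum>k<N. \<Sum>j<N. C * ((P i j)\<^sup>2 * \<bar>y ((k + j) mod N)\<bar> powr p))"
      by (rule sum.swap)
    also have "\<dots> = (\<Sum>i<N. \<Sum>j<N. \<Sum>k<N. C * ((P i j)\<^sup>2 * \<bar>y ((k + j) mod N)\<bar> powr p))"
      by (intro sum.cong refl sum.swap)
    finally show ?thesis by (simp add: sum_distrib_left mult.assoc)
  qed
  also have "\<dots> = (\<Sum>i<N. \<Sum>j<N. C * (P i j)\<^sup>2 * S)"
    unfolding S_def by (subst sum_cyclic_shift[where h = "\<lambda>k. \<bar>y k\<bar> powr p"]) simp
  also have "\<dots> = C * (\<Sum>i<N. \<Sum>j<N. (P i j)\<^sup>2) * S"
    by (simp add: sum_distrib_left sum_distrib_right)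
  also have "(\<Sum>i<N. \<Sum>j<N. (P i j)\<^sup>2) = (\<Sum>i<N. P i i)"
    using projection_diagonal(1)[OF P] by (intro sum.cong) auto
  finally show ?thesis by (simp add: C_def S_def)
qed

text \<open>
  A vector that gives equality in Hoelder's inequality against \<open>x\<close> with exponents \<open>q\<close> and \<open>q / (q - 1)\<close>.
\<close>
definition dual_vector :: "real \<Rightarrow> (nat \<Rightarrow> real) \<Rightarrow> nat \<Rightarrow> real" where
  "dual_vector q x i = sgn (x i) * \<bar>x i\<bar> powr (q - 1)"

lemma mult_dual_vector: "x i * dual_vector q x i = \<bar>x i\<bar> powr q"
proof -
  have "x i * dual_vector q x i = \<bar>x i\<bar> * \<bar>x i\<bar> powr (q - 1)"
    by (simp add: dual_vector_def abs_sgn mult_ac)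
  then show ?thesis by (cases "x i = 0") (auto simp: powr_mult_base)
qed

lemma abs_dual_vector_powr:
  assumes "1 < q"
  shows "\<bar>dual_vector q x i\<bar> powr (q / (q - 1)) = \<bar>x i\<bar> powr q"
  using assms by (cases "x i = 0") (auto simp: dual_vector_def abs_mult powr_powr)

lemma lq_norm_nonneg: "0 \<le> lq_norm q N x"
  by (simp add: lq_norm_def)

lemma lq_norm_powr:
  assumes "1 < q"
  shows "lq_norm q N x powr q = (\<Sum>k<N. \<bar>x k\<bar> powr q)"
  using assms by (simp add: lq_norm_def powr_powr sum_nonneg)

lemma lq_dist_le: "u \<in> Q \<Longrightarrow> lq_dist q N x Q \<le> lq_norm q N (x - u)"
  unfolding lq_dist_def by (intro cINF_lower bdd_belowI2[of _ 0] lq_norm_nonneg)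

lemma lq_dist_greatest:
  "Q \<noteq> {} \<Longrightarrow> (\<And>u. u \<in> Q \<Longrightarrow> m \<le> lq_norm q N (x - u)) \<Longrightarrow> m \<le> lq_dist q N x Q"
  unfolding lq_dist_def by (rule cINF_greatest)

lemma lq_norm_act: "g \<in> sign_shift_group N \<Longrightarrow> lq_norm q N (act N g x) = lq_norm q N x"
proof -
  have "(\<Sum>i<N. \<bar>act N (\<tau>, k) x i\<bar> powr q) = (\<Sum>i<N. \<bar>x i\<bar> powr q)" for \<tau> k
    using sum_cyclic_shift[where h = "\<lambda>i. \<bar>x i\<bar> powr q" and i = k and N = N]
    by (simp add: act_def abs_mult power_abs add.commute)
  then show ?thesis by (cases g) (simp add: lq_norm_def)
qed

text \<open>
  The vector \<open>P w\<close> is orthogonal to \<open>Q\<close>, so \<open>z\<close> may be replaced by \<open>z - u\<close> for any \<open>u\<close> in \<open>Q\<close> before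
  Young's inequality is applied in each coordinate.
\<close>

lemma bilinear_form_le_lq_dist:
  assumes q: "1 < q" and \<delta>: "0 < \<delta>" and Q: "Q \<noteq> {}" and P: "annihilating_projection N Q P"
  shows "(\<Sum>i<N. \<Sum>j<N. P i j * (z i * w j))
    \<le> \<delta> powr (1 - q) * lq_dist q N z Q powr q
      + \<delta> * (\<Sum>i<N. \<bar>\<Sum>j<N. P i j * w j\<bar> powr (q / (q - 1)))"
    (is "?f \<le> ?K * _ + \<delta> * ?W")
proof -
  have K: "0 < ?K" using \<delta> by simp
  have bound: "?f \<le> ?K * lq_norm q N (z - u) powr q + \<delta> * ?W" if "u \<in> Q" for u
  proof -
    define h where "h i = (\<Sum>j<N. P i j * w j)" for i
    have "(\<Sum>i<N. u i * h i) = (\<Sum>j<N. (\<Sum>i<N. P j i * u i) * w j)"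
    proof -
      have "(\<Sum>i<N. u i * h i) = (\<Sum>j<N. \<Sum>i<N. u i * (P i j * w j))"
        by (subst sum.swap) (simp add: h_def sum_distrib_left)
      also have "\<dots> = (\<Sum>j<N. (\<Sum>i<N. P j i * u i) * w j)"
        using annihilating_projectionD(1)[OF P]
        by (auto simp: sum_distrib_left sum_distrib_right mult_ac intro!: sum.cong)
      finally show ?thesis .
    qed
    also have "\<dots> = 0" using annihilating_projectionD(3)[OF P that] by simp
    finally have "(\<Sum>i<N. u i * h i) = 0" .
    moreover have "?f = (\<Sum>i<N. z i * h i)"
      by (simp add: h_def sum_distrib_left mult_ac)
    ultimately have "?f = (\<Sum>i<N. (z - u) i * h i)"
      by (simp add: left_diff_distrib sum_subtractf)
    also have "\<dots> \<le> (\<Sum>i<N. \<bar>(z - u) i\<bar> * \<bar>h i\<bar>)"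
      by (intro sum_mono) (metis abs_ge_self abs_mult)
    also have "\<dots> \<le> (\<Sum>i<N. ?K * \<bar>(z - u) i\<bar> powr q + \<delta> * \<bar>h i\<bar> powr (q / (q - 1)))"
      using q \<delta> by (intro sum_mono young_with_small_constant) auto
    finally show ?thesis
      by (simp only: sum.distrib sum_distrib_left lq_norm_powr[OF q] h_def)
  qed
  \<comment> \<open>The infimum is taken over norms and not over their \<open>q\<close>-th powers, so the bound is solved for the
      norm first; the maximum with 0 makes the real power monotone.\<close>
  have "max 0 ((?f - \<delta> * ?W) / ?K) powr (1 / q) \<le> lq_norm q N (z - u)" if "u \<in> Q" for u
  proof -
    have "max 0 ((?f - \<delta> * ?W) / ?K) \<le> lq_norm q N (z - u) powr q"
      using bound[OF that] K by (simp add: field_simps)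
    then have "max 0 ((?f - \<delta> * ?W) / ?K) powr (1 / q) \<le> (lq_norm q N (z - u) powr q) powr (1 / q)"
      using q by (intro powr_mono2) auto
    then show ?thesis using q lq_norm_nonneg by (simp add: powr_powr)
  qed
  then have "max 0 ((?f - \<delta> * ?W) / ?K) powr (1 / q) \<le> lq_dist q N z Q"
    by (intro lq_dist_greatest Q)
  then have "(max 0 ((?f - \<delta> * ?W) / ?K) powr (1 / q)) powr q \<le> lq_dist q N z Q powr q"
    using q by (intro powr_mono2) auto
  then have "max 0 ((?f - \<delta> * ?W) / ?K) \<le> lq_dist q N z Q powr q"
    using q by (simp add: powr_powr)
  then show ?thesis using K by (simp add: field_simps)
qed

text \<open>
  The mean of \<open>\<rho>\<^sup>q\<close> in unnormalized form: the group has \<open>2\<^sup>N N\<close> elements, so dividing by its order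
  turns \<open>(N - n) 2\<^sup>N\<close> into \<open>1 - n / N\<close>.
\<close>

lemma sum_lq_dist_powr_ge:
  fixes q :: real
  assumes q: "1 < q" "q \<le> 2"
  shows "\<exists>\<kappa>>0. \<forall>N n x Q. subspace Q \<longrightarrow> Q \<subseteq> real_space N \<longrightarrow> dim Q \<le> n \<longrightarrow>
    \<kappa> * (real N - real n) * 2 ^ N * lq_norm q N x powr q
      \<le> (\<Sum>g\<in>sign_shift_group N. lq_dist q N (act N g x) Q powr q)"
proof -
  define p where "p = q / (q - 1)"
  have p: "2 \<le> p" using q by (simp add: p_def field_simps)
  define C where "C = 2 * exp 1 * p powr p"
  have C: "0 < C" using p by (simp add: C_def)
  define K where "K = (1 / (2 * C)) powr (1 - q)"
  have K: "0 < K" using C by (simp add: K_def)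
  \<comment> \<open>The weight \<open>1 / (2 * C)\<close> in Young's inequality is chosen so that the average of the dual term is
      at most half of the average of the bilinear form.\<close>
  have main: "1 / (2 * K) * (real N - real n) * 2 ^ N * lq_norm q N x powr q
      \<le> (\<Sum>g\<in>sign_shift_group N. lq_dist q N (act N g x) Q powr q)" (is "_ \<le> ?D")
    if Q: "subspace Q" "Q \<subseteq> real_space N" "dim Q \<le> n" for N n x Q
  proof -
    obtain P where P: "annihilating_projection N Q P"
      and tr: "real N - real (dim Q) \<le> (\<Sum>i<N. P i i)"
      using annihilating_projection_subspace[OF Q(2)] by blast
    define T where "T = (\<Sum>i<N. P i i)"
    define A where "A = (\<Sum>k<N. \<bar>x k\<bar> powr q)"
    define y where "y = dual_vector q x"
    define W where "W g = (\<Sum>i<N. \<bar>\<Sum>j<N. P i j * act N g y j\<bar> powr p)" for g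
    have A: "0 \<le> A" by (simp add: A_def sum_nonneg)
    have "2 ^ N * T * A = (\<Sum>g\<in>sign_shift_group N. \<Sum>i<N. \<Sum>j<N. P i j * (act N g x i * act N g y j))"
      unfolding sum_act_quadratic_form by (simp add: T_def A_def y_def mult_dual_vector)
    also have "\<dots> \<le> (\<Sum>g\<in>sign_shift_group N. K * lq_dist q N (act N g x) Q powr q + 1 / (2 * C) * W g)"
      unfolding K_def W_def p_def
      using q(1) C subspace_0[OF Q(1)] by (intro sum_mono bilinear_form_le_lq_dist P) auto
    also have "\<dots> = K * ?D + 1 / (2 * C) * (\<Sum>g\<in>sign_shift_group N. W g)"
      by (simp only: sum.distrib sum_distrib_left)
    also have "\<dots> \<le> K * ?D + 1 / (2 * C) * (C * 2 ^ N * T * A)"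
    proof -
      have "(\<Sum>g\<in>sign_shift_group N. W g) \<le> C * 2 ^ N * T * A"
        using sum_act_projection_powr_le[OF P p, of y] q(1)
        by (simp add: W_def C_def T_def A_def y_def p_def abs_dual_vector_powr)
      then show ?thesis using C by (intro add_left_mono mult_left_mono) auto
    qed
    finally have "2 ^ N * T * A \<le> 2 * K * ?D" using C by simp
    moreover have "(real N - real n) * (2 ^ N * A) \<le> T * (2 ^ N * A)"
      using tr Q(3) A by (intro mult_right_mono) (auto simp: T_def)
    ultimately have "(real N - real n) * (2 ^ N * A) \<le> 2 * K * ?D" by (simp add: mult_ac)
    then show ?thesis
      using K by (simp add: lq_norm_powr[OF q(1)] A_def[symmetric] field_simps)
  qed
  show ?thesis using main K by (intro exI[of _ "1 / (2 * K)"]) auto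
qed

section \<open>The width and the probability bound\<close>

lemma group_order_mult:
  assumes "n < N"
  shows "(1 - real n / real N) * card (sign_shift_group N) = (real N - real n) * 2 ^ N"
  using assms by (simp add: card_sign_shift_group field_simps)

lemma sign_shift_group_nonempty: "n < N \<Longrightarrow> sign_shift_group N \<noteq> {}"
  using card_sign_shift_group[of N] by auto

lemma scaled_powr_root:
  assumes "1 < q" "0 \<le> c" "0 \<le> \<epsilon>"
  shows "(c * \<epsilon> * lq_norm q N x powr q) powr (1 / q) = c powr (1 / q) * \<epsilon> powr (1 / q) * lq_norm q N x"
  using assms lq_norm_nonneg[of q N x] by (simp add: powr_mult powr_powr)

lemma avg_width_ge:
  assumes q: "1 < q" and \<kappa>: "0 < \<kappa>" and nN: "n < N"
    and sum_ge: "\<And>V. subspace V \<Longrightarrow> V \<subseteq> real_space N \<Longrightarrow> dim V \<le> n \<Longrightarrow>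
      \<kappa> * (real N - real n) * 2 ^ N * lq_norm q N x powr q
        \<le> (\<Sum>g\<in>sign_shift_group N. lq_dist q N (act N g x) V powr q)"
  shows "\<kappa> powr (1 / q) * (1 - real n / real N) powr (1 / q) * lq_norm q N x
    \<le> avg_width q N n (measure_pmf (pmf_of_set (sign_shift_group N))) (\<lambda>g. act N g x)"
proof -
  define \<epsilon> where "\<epsilon> = 1 - real n / real N"
  define A where "A = lq_norm q N x powr q"
  have A: "0 \<le> A" by (simp add: A_def)
  have \<epsilon>: "0 < \<epsilon>" using nN by (simp add: \<epsilon>_def field_simps)
  have fin: "finite (sign_shift_group N)" by (rule finite_sign_shift_group)
  have ne: "sign_shift_group N \<noteq> {}" using nN by (rule sign_shift_group_nonempty)
  have "(\<kappa> * \<epsilon> * A) powr (1 / q)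
      \<le> avg_width q N n (measure_pmf (pmf_of_set (sign_shift_group N))) (\<lambda>g. act N g x)"
    unfolding avg_width_def
  proof (rule cINF_greatest)
    have "dim {0 :: nat \<Rightarrow> real} \<le> n"
      using dim_span_eq_card_independent[OF independent_empty, where 'a = "nat \<Rightarrow> real"] by simp
    moreover have "subspace {0 :: nat \<Rightarrow> real}" "{0} \<subseteq> real_space N"
      by (auto simp: real_space_def subspace_single_0)
    ultimately show "{Q. subspace Q \<and> Q \<subseteq> real_space N \<and> dim Q \<le> n} \<noteq> {}" by blast
    fix V assume V: "V \<in> {Q. subspace Q \<and> Q \<subseteq> real_space N \<and> dim Q \<le> n}"
    have "\<kappa> * \<epsilon> * A * card (sign_shift_group N) = \<kappa> * (\<epsilon> * card (sign_shift_group N)) * A"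
      by simp
    also have "\<dots> = \<kappa> * (real N - real n) * 2 ^ N * A"
      unfolding \<epsilon>_def group_order_mult[OF nN] by simp
    also have "\<dots> \<le> (\<Sum>g\<in>sign_shift_group N. lq_dist q N (act N g x) V powr q)"
      unfolding A_def using V by (intro sum_ge) auto
    finally have "\<kappa> * \<epsilon> * A \<le> (\<Sum>g\<in>sign_shift_group N. lq_dist q N (act N g x) V powr q)
        / card (sign_shift_group N)"
      using fin ne by (simp add: field_simps card_gt_0_iff)
    then show "(\<kappa> * \<epsilon> * A) powr (1 / q) \<le> (LINT g|measure_pmf (pmf_of_set (sign_shift_group N)).
        lq_dist q N (act N g x) V powr q) powr (1 / q)"
      unfolding integral_pmf_of_set[OF ne fin] using q \<kappa> \<epsilon> A by (intro powr_mono2) auto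
  qed
  then show ?thesis
    using q \<kappa> \<epsilon> by (simp add: A_def scaled_powr_root \<epsilon>_def)
qed

text \<open>
  A reverse Markov inequality: on the event \<open>E\<close> the \<open>q\<close>-th power of the distance is at most that of
  the norm of \<open>x\<close>, because \<open>0\<close> lies in \<open>Q\<close> and the action is isometric; off \<open>E\<close> it is at most half of
  the lower bound for its mean. The minimum with 1 covers \<open>x = 0\<close>, where the mean gives no
  information but the event is certain.
\<close>

lemma prob_lq_dist_ge:
  assumes q: "1 < q" and \<kappa>: "0 < \<kappa>" and nN: "n < N" and Q: "0 \<in> Q"
    and sum_ge: "\<kappa> * (real N - real n) * 2 ^ N * lq_norm q N x powr q
        \<le> (\<Sum>g\<in>sign_shift_group N. lq_dist q N (act N g x) Q powr q)"
  shows "min (\<kappa> / 2) 1 * (1 - real n / real N)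
    \<le> measure_pmf.prob (pmf_of_set (sign_shift_group N))
      {g. (\<kappa> / 2) powr (1 / q) * (1 - real n / real N) powr (1 / q) * lq_norm q N x
        \<le> lq_dist q N (act N g x) Q}"
proof -
  define G where "G = sign_shift_group N"
  define \<epsilon> where "\<epsilon> = 1 - real n / real N"
  define A where "A = lq_norm q N x powr q"
  have A: "0 \<le> A" by (simp add: A_def)
  have \<epsilon>: "0 < \<epsilon>" "\<epsilon> \<le> 1" using nN by (simp_all add: \<epsilon>_def field_simps)
  have fin: "finite G" unfolding G_def by (rule finite_sign_shift_group)
  have ne: "G \<noteq> {}" unfolding G_def using nN by (rule sign_shift_group_nonempty)
  with fin have cG: "0 < real (card G)" by (simp add: card_gt_0_iff)
  define E where "E = {g. (\<kappa> / 2 * \<epsilon> * A) powr (1 / q) \<le> lq_dist q N (act N g x) Q}"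
  have dist_nonneg: "0 \<le> lq_dist q N z Q" for z
    using Q by (intro lq_dist_greatest lq_norm_nonneg) auto
  have dist_le: "lq_dist q N (act N g x) Q powr q \<le> (if g \<in> E then A else 0) + \<kappa> / 2 * \<epsilon> * A"
    if "g \<in> G" for g
  proof (cases "g \<in> E")
    case True
    have "lq_dist q N (act N g x) Q \<le> lq_norm q N x"
      using lq_dist_le[OF Q, of q N "act N g x"] lq_norm_act[of g N q x] that
      by (simp add: G_def)
    then have "lq_dist q N (act N g x) Q powr q \<le> A"
      unfolding A_def using dist_nonneg q by (intro powr_mono2) auto
    then show ?thesis using True \<kappa> \<epsilon> A by (simp add: add_increasing2)
  next
    case False
    then have "lq_dist q N (act N g x) Q powr q \<le> ((\<kappa> / 2 * \<epsilon> * A) powr (1 / q)) powr q"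
      using dist_nonneg q by (intro powr_mono2) (auto simp: E_def)
    then show ?thesis using False q \<kappa> \<epsilon> A by (simp add: powr_powr)
  qed
  have "min (\<kappa> / 2) 1 * \<epsilon> \<le> card (G \<inter> E) / card G"
  proof (cases "A = 0")
    case True
    then have "E = UNIV" using dist_nonneg by (simp add: E_def)
    moreover have "min (\<kappa> / 2) 1 * \<epsilon> \<le> 1 * 1" using \<epsilon> \<kappa> by (intro mult_mono) auto
    ultimately show ?thesis using cG by simp
  next
    case False
    with A have A': "0 < A" by simp
    have "A * (\<kappa> * \<epsilon> * card G) = \<kappa> * (\<epsilon> * card G) * A" by simp
    also have "\<dots> = \<kappa> * (real N - real n) * 2 ^ N * A"
      unfolding \<epsilon>_def G_def group_order_mult[OF nN] by simp
    also have "\<dots> \<le> (\<Sum>g\<in>G. lq_dist q N (act N g x) Q powr q)"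
      using sum_ge by (simp add: A_def G_def)
    also have "\<dots> \<le> (\<Sum>g\<in>G. (if g \<in> E then A else 0) + \<kappa> / 2 * \<epsilon> * A)"
      by (intro sum_mono dist_le)
    also have "\<dots> = A * (card (G \<inter> E) + \<kappa> / 2 * \<epsilon> * card G)"
      using fin by (simp add: sum.distrib sum.If_cases algebra_simps)
    finally have "\<kappa> * \<epsilon> * card G \<le> card (G \<inter> E) + \<kappa> / 2 * \<epsilon> * card G"
      using A' by simp
    then have "\<kappa> / 2 * \<epsilon> \<le> card (G \<inter> E) / card G" using cG by (simp add: field_simps)
    moreover have "min (\<kappa> / 2) 1 * \<epsilon> \<le> \<kappa> / 2 * \<epsilon>" using \<epsilon> by (intro mult_right_mono) auto
    ultimately show ?thesis by linarith
  qed
  moreover have "E = {g. (\<kappa> / 2) powr (1 / q) * \<epsilon> powr (1 / q) * lq_norm q N x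
      \<le> lq_dist q N (act N g x) Q}"
    using \<kappa> \<epsilon> q unfolding E_def A_def by (subst scaled_powr_root) auto
  ultimately show ?thesis
    by (simp add: measure_pmf_of_set[OF ne fin] G_def[symmetric] \<epsilon>_def)
qed

theorem mainTheorem6:
  fixes q :: real
  assumes "1 < q" and "q \<le> 2"
  shows "\<exists>c c1 c2 :: real. c > 0 \<and> c1 > 0 \<and> c2 > 0 \<and>
    (\<forall>N n :: nat. n < N \<longrightarrow> (\<forall>x \<in> real_space N.
       avg_width q N n (measure_pmf (pmf_of_set (sign_shift_group N))) (\<lambda>g. act N g x)
         \<ge> c * (1 - real n / real N) powr (1 / q) * lq_norm q N x \<and>
       (\<forall>Q. subspace Q \<and> Q \<subseteq> real_space N \<and> dim Q = n \<longrightarrow>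
         measure_pmf.prob (pmf_of_set (sign_shift_group N))
           {g. lq_dist q N (act N g x) Q \<ge> c1 * (1 - real n / real N) powr (1 / q) * lq_norm q N x}
           \<ge> c2 * (1 - real n / real N))))"
proof -
  obtain \<kappa> where \<kappa>: "0 < \<kappa>"
    and sum_ge: "\<And>N n x Q. subspace Q \<Longrightarrow> Q \<subseteq> real_space N \<Longrightarrow> dim Q \<le> n \<Longrightarrow>
      \<kappa> * (real N - real n) * 2 ^ N * lq_norm q N x powr q
        \<le> (\<Sum>g\<in>sign_shift_group N. lq_dist q N (act N g x) Q powr q)"
    using sum_lq_dist_powr_ge[OF assms] by blast
  show ?thesis
    using \<kappa> assms(1)
    by (intro exI[of _ "\<kappa> powr (1 / q)"] exI[of _ "(\<kappa> / 2) powr (1 / q)"] exI[of _ "min (\<kappa> / 2) 1"]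
        conjI allI impI ballI avg_width_ge prob_lq_dist_ge sum_ge) (auto intro: subspace_0)
qed

end
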